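(* There is a polynomial-time many-one reduction from Pinwheel Scheduling to the decision version of \textsc{min-avg} RFTT restricted to instances whose graph is series-parallel. That is, \textsc{min-avg} RFTT on series-parallel graphs is at least as hard as Pinwheel Scheduling.
   Context: Replenishment problem with fixed turnover times (RFTT): an instance is a pair $(G,\tau)$ where $G=(V\cup\{s\},E,c)$ is a connected graph with a designated depot vertex $s$, nonnegative edge weights $c:E\to\mathbb{R}_+$, and clients $V=\{v_1,\dots,v_n\}$ with turnover times $\tau\in\mathbb{N}^{n}$. A solution assigns to each day $k\in\{1,2,\dots\}$ a closed walk (tour) $T_k$ in $G$ starting and ending at $s$, together with a set $J_k\subseteq V$ of clients on $T_k$ that are visited on day $k$. It is feasible if for every $t\ge 0$ and every $v_j\in V$ we have $v_j\in\bigcup_{k=t+1}^{t+\tau_j}J_k$. Solutions are required to be periodic: there is $\ell$ with $T_{k+\ell}=T_k$ and $J_{k+\ell}=J_k$ for all $k$. The length $c(T_k)$ of a tour is the sum of the weights of its edges counted with multiplicity. In \textsc{min-avg} RFTT the objective is the average tour length $\frac1\ell\sum_{k=1}^{\ell}c(T_k)$ over a period, to be minimized; its decision version asks, given $(G,\tau)$ and a number $B$, whether a feasible solution with objective at most $B$ exists. Pinwheel Scheduling: given positive integers $p_1,\dots,p_n$, decide whether there is $\sigma:\mathbb{N}\to\{1,\dots,n\}$ with $j\in\{\sigma(t+1),\dots,\sigma(t+p_j)\}$ for all $t\ge0$ and all $j$. *)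

theory Defs
  imports Complex_Main "HOL-Computational_Algebra.Polynomial"
begin

section \<open>Polynomial-time computation\<close>

text \<open>
  Deterministic multitape Turing machines with tapes that are infinite in both directions. The
  input alphabet consists of the two bits and a separator; the tape alphabet additionally has the
  blank, \<^term>\<open>None\<close>. A machine \<open>M\<close> has the states \<open>0, \<dots>, nstates M\<close>, where \<open>0\<close> is initial
  and \<open>nstates M\<close> is the halting state, so only finitely many values of
  \<open>delta M\<close> matter: those at \<open>q < nstates M\<close> and lists of \<open>ntapes M\<close> scanned symbols.
  The input is on tape 0 and the output is read off tape 1.
\<close>

datatype symbol = Bit bool | Sep

datatype move = Move_Left | Stay | Move_Right

record tm =
  ntapes :: nat
  nstates :: nat
  delta :: "nat \<Rightarrow> symbol option list \<Rightarrow> nat \<times> (symbol option \<times> move) list"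

definition wf_tm :: "tm \<Rightarrow> bool" where
  "wf_tm M \<longleftrightarrow> 2 \<le> ntapes M \<and>
    (\<forall>q < nstates M. \<forall>rs. length rs = ntapes M \<longrightarrow>
      fst (delta M q rs) \<le> nstates M \<and> length (snd (delta M q rs)) = ntapes M)"

type_synonym tape = "(int \<Rightarrow> symbol option) \<times> int"  \<comment> \<open>cell contents and head position\<close>

type_synonym config = "nat \<times> tape list"

definition string_tape :: "symbol list \<Rightarrow> int \<Rightarrow> symbol option" where
  "string_tape xs i = (if 0 \<le> i \<and> i < int (length xs) then Some (xs ! nat i) else None)"

fun offset :: "move \<Rightarrow> int" where
  "offset Move_Left = -1"
| "offset Stay = 0"
| "offset Move_Right = 1"

fun act :: "symbol option \<times> move \<Rightarrow> tape \<Rightarrow> tape" where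
  "act (b, m) (f, h) = (f(h := b), h + offset m)"

fun step :: "tm \<Rightarrow> config \<Rightarrow> config" where
  "step M (q, ts) =
    (if q = nstates M then (q, ts)
     else let (q', as) = delta M q (map (\<lambda>(f, h). f h) ts) in (q', map2 act as ts))"

definition initial_config :: "tm \<Rightarrow> symbol list \<Rightarrow> config" where
  "initial_config M xs =
    (0, (string_tape xs, 0) # replicate (ntapes M - 1) (string_tape [], 0))"

text \<open>Halting configurations are fixed points of \<^const>\<open>step\<close>, so this means ``within \<open>t\<close> steps''.\<close>

definition outputs_within :: "tm \<Rightarrow> symbol list \<Rightarrow> symbol list \<Rightarrow> nat \<Rightarrow> bool" where
  "outputs_within M xs ys t \<longleftrightarrow>
    (case (step M ^^ t) (initial_config M xs) of
      (q, ts) \<Rightarrow> q = nstates M \<and> fst (ts ! 1) = string_tape ys)"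


section \<open>Decision problems and many-one reductions\<close>

record 'a problem =
  instances :: "'a set"
  yes :: "'a \<Rightarrow> bool"
  encode :: "'a \<Rightarrow> symbol list"

definition poly_time_map :: "'a problem \<Rightarrow> 'b problem \<Rightarrow> ('a \<Rightarrow> 'b) \<Rightarrow> bool" where
  "poly_time_map A B f \<longleftrightarrow>
    (\<exists>M (p :: nat poly). wf_tm M \<and>
      (\<forall>x \<in> instances A.
        outputs_within M (encode A x) (encode B (f x)) (poly p (length (encode A x)))))"

definition poly_time_many_one_reducible :: "'a problem \<Rightarrow> 'b problem \<Rightarrow> bool" where
  "poly_time_many_one_reducible A B \<longleftrightarrow>
    (\<exists>f. (\<forall>x \<in> instances A. f x \<in> instances B \<and> (yes A x \<longleftrightarrow> yes B (f x))) \<and>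
      poly_time_map A B f)"

text \<open>Numbers are written in binary, least significant bit first, and terminated by a separator.\<close>

fun binary :: "nat \<Rightarrow> bool list" where
  "binary n = (if n = 0 then [] else odd n # binary (n div 2))"

declare binary.simps [simp del]

definition encode_nats :: "nat list \<Rightarrow> symbol list" where
  "encode_nats ns = concat (map (\<lambda>n. map Bit (binary n) @ [Sep]) ns)"

definition nats_of_rat :: "rat \<Rightarrow> nat list" where  \<comment> \<open>only used for nonnegative numbers\<close>
  "nats_of_rat q = (case quotient_of q of (a, b) \<Rightarrow> [nat a, nat b])"


section \<open>Pinwheel Scheduling\<close>

text \<open>The periods are indexed from \<open>0\<close>.\<close>

definition pinwheel_schedule :: "nat list \<Rightarrow> (nat \<Rightarrow> nat) \<Rightarrow> bool" where
  "pinwheel_schedule ps \<sigma> \<longleftrightarrow>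
    (\<forall>k. \<sigma> k < length ps) \<and> (\<forall>t. \<forall>j < length ps. j \<in> \<sigma> ` {t + 1..t + ps ! j})"

definition pinwheel :: "nat list problem" where
  "pinwheel =
    \<lparr> instances = {ps. \<forall>p \<in> set ps. 0 < p},
      yes = (\<lambda>ps. \<exists>\<sigma>. pinwheel_schedule ps \<sigma>),
      encode = encode_nats \<rparr>"


section \<open>Graphs\<close>

text \<open>Finite simple graphs, with edges as two-element sets of vertices.\<close>

definition graph :: "'v set \<Rightarrow> 'v set set \<Rightarrow> bool" where
  "graph V E \<longleftrightarrow> finite V \<and> E \<subseteq> {{u, v} | u v. u \<in> V \<and> v \<in> V \<and> u \<noteq> v}"

definition walk :: "'v set \<Rightarrow> 'v set set \<Rightarrow> 'v list \<Rightarrow> bool" where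
  "walk V E w \<longleftrightarrow> w \<noteq> [] \<and> set w \<subseteq> V \<and> successively (\<lambda>u v. {u, v} \<in> E) w"

definition connected_graph :: "'v set \<Rightarrow> 'v set set \<Rightarrow> bool" where
  "connected_graph V E \<longleftrightarrow>
    (\<forall>u \<in> V. \<forall>v \<in> V. \<exists>w. walk V E w \<and> hd w = u \<and> last w = v)"

text \<open>
  Two-terminal series-parallel graphs. Every subgraph occurring in a decomposition of a simple graph
  is simple, so no multigraphs are needed; disjointness of the edge sets in a parallel composition
  excludes parallel edges.
\<close>

inductive two_terminal_sp :: "'v set \<Rightarrow> 'v set set \<Rightarrow> 'v \<Rightarrow> 'v \<Rightarrow> bool" where
  edge: "a \<noteq> b \<Longrightarrow> two_terminal_sp {a, b} {{a, b}} a b"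
| series: "\<lbrakk>two_terminal_sp V\<^sub>1 E\<^sub>1 a m; two_terminal_sp V\<^sub>2 E\<^sub>2 m b; V\<^sub>1 \<inter> V\<^sub>2 = {m}\<rbrakk>
    \<Longrightarrow> two_terminal_sp (V\<^sub>1 \<union> V\<^sub>2) (E\<^sub>1 \<union> E\<^sub>2) a b"
| parallel: "\<lbrakk>two_terminal_sp V\<^sub>1 E\<^sub>1 a b; two_terminal_sp V\<^sub>2 E\<^sub>2 a b;
      V\<^sub>1 \<inter> V\<^sub>2 = {a, b}; E\<^sub>1 \<inter> E\<^sub>2 = {}\<rbrakk>
    \<Longrightarrow> two_terminal_sp (V\<^sub>1 \<union> V\<^sub>2) (E\<^sub>1 \<union> E\<^sub>2) a b"

definition series_parallel :: "'v set \<Rightarrow> 'v set set \<Rightarrow> bool" where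
  "series_parallel V E \<longleftrightarrow> (\<exists>a b. two_terminal_sp V E a b)"


section \<open>The replenishment problem with fixed turnover times\<close>

record 'v rftt =
  depot :: 'v
  clients :: "'v set"
  edges :: "'v set set"
  weight :: "'v set \<Rightarrow> real"
  turnover :: "'v \<Rightarrow> nat"

definition verts :: "'v rftt \<Rightarrow> 'v set" where
  "verts I = insert (depot I) (clients I)"

definition is_rftt :: "'v rftt \<Rightarrow> bool" where
  "is_rftt I \<longleftrightarrow>
    depot I \<notin> clients I \<and>
    graph (verts I) (edges I) \<and>
    connected_graph (verts I) (edges I) \<and>
    (\<forall>e \<in> edges I. 0 \<le> weight I e) \<and>
    (\<forall>v \<in> clients I. 0 < turnover I v)"

definition tour :: "'v rftt \<Rightarrow> 'v list \<Rightarrow> bool" where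
  "tour I w \<longleftrightarrow> walk (verts I) (edges I) w \<and> hd w = depot I \<and> last w = depot I"

definition tour_length :: "'v rftt \<Rightarrow> 'v list \<Rightarrow> real" where
  "tour_length I w = (\<Sum>(u, v) \<leftarrow> zip w (tl w). weight I {u, v})"

text \<open>Days are numbered from \<open>1\<close>; the values of \<open>T\<close> and \<open>J\<close> at \<open>0\<close> are irrelevant.\<close>

definition feasible :: "'v rftt \<Rightarrow> (nat \<Rightarrow> 'v list) \<Rightarrow> (nat \<Rightarrow> 'v set) \<Rightarrow> bool" where
  "feasible I T J \<longleftrightarrow>
    (\<forall>k \<ge> 1. tour I (T k) \<and> J k \<subseteq> clients I \<inter> set (T k)) \<and>
    (\<forall>t. \<forall>v \<in> clients I. v \<in> (\<Union>k \<in> {t + 1..t + turnover I v}. J k))"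

definition has_period :: "(nat \<Rightarrow> 'v list) \<Rightarrow> (nat \<Rightarrow> 'v set) \<Rightarrow> nat \<Rightarrow> bool" where
  "has_period T J l \<longleftrightarrow> 1 \<le> l \<and> (\<forall>k \<ge> 1. T (k + l) = T k \<and> J (k + l) = J k)"

definition average_length :: "'v rftt \<Rightarrow> (nat \<Rightarrow> 'v list) \<Rightarrow> nat \<Rightarrow> real" where
  "average_length I T l = (\<Sum>k = 1..l. tour_length I (T k)) / real l"

definition min_avg_at_most :: "'v rftt \<Rightarrow> real \<Rightarrow> bool" where
  "min_avg_at_most I B \<longleftrightarrow>
    (\<exists>T J l. feasible I T J \<and> has_period T J l \<and> average_length I T l \<le> B)"

text \<open>
  As input to an algorithm, an instance has depot \<open>0\<close>, clients \<open>1, \<dots>, n\<close>, and rational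
  edge weights and bound; an entry \<open>(u, v, q)\<close> of the edge list is an edge \<open>{u, v}\<close> of weight \<open>q\<close>.
\<close>

record rftt_input =
  turnovers :: "nat list"
  edge_list :: "(nat \<times> nat \<times> rat) list"
  bound :: rat

definition weighted_edges :: "rftt_input \<Rightarrow> (nat set \<times> rat) list" where
  "weighted_edges x = map (\<lambda>(u, v, q). ({u, v}, q)) (edge_list x)"

definition rftt_of :: "rftt_input \<Rightarrow> nat rftt" where
  "rftt_of x =
    \<lparr> depot = 0,
      clients = {1..length (turnovers x)},
      edges = fst ` set (weighted_edges x),
      weight = (\<lambda>e. real_of_rat (the (map_of (weighted_edges x) e))),
      turnover = (\<lambda>v. turnovers x ! (v - 1)) \<rparr>"

definition encode_rftt :: "rftt_input \<Rightarrow> symbol list" where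
  "encode_rftt x = encode_nats
    (length (turnovers x) # turnovers x @ nats_of_rat (bound x) @
     concat (map (\<lambda>(u, v, q). [u, v] @ nats_of_rat q) (edge_list x)))"

definition min_avg_rftt :: "rftt_input problem" where
  "min_avg_rftt =
    \<lparr> instances = {x. is_rftt (rftt_of x) \<and> distinct (map fst (weighted_edges x)) \<and> 0 \<le> bound x},
      yes = (\<lambda>x. min_avg_at_most (rftt_of x) (real_of_rat (bound x))),
      encode = encode_rftt \<rparr>"

definition min_avg_rftt_series_parallel :: "rftt_input problem" where
  "min_avg_rftt_series_parallel = min_avg_rftt
    \<lparr> instances := {x \<in> instances min_avg_rftt.
        series_parallel (verts (rftt_of x)) (edges (rftt_of x))} \<rparr>"

end

theory Submission
  imports Defs
begin

text \<open>
  Join the depot \<open>0\<close> and a vertex \<open>2\<close> by paths of length two: one through the vertex \<open>1\<close> with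
  edges of weight \<open>2\<close>, and one with unit edges through each job of the pinwheel instance. The
  vertices \<open>1\<close> and \<open>2\<close> have turnover time \<open>1\<close>, the jobs keep their periods, and the bound is
  \<open>6\<close>. A tour through \<open>1\<close> and \<open>2\<close> has length at least \<open>6\<close>, with equality iff it passes
  \<open>1\<close> once and exactly one job once; so an average of \<open>6\<close> forces exactly one job per day. Since
  the edges at \<open>1\<close> are the more expensive ones, the instance without jobs, which has no pinwheel
  schedule, is also mapped to a no-instance. Conversely a schedule can be made periodic by the
  pigeonhole principle.
\<close>

section \<open>Periodic pinwheel schedules\<close>

text \<open>Blocks of \<open>Suc P\<close> consecutive days take only finitely many values, so two
  of them, starting at days \<open>a < b\<close>, coincide. Repeating days \<open>a\<close> to
  \<open>b - 1\<close> forever then agrees with the shifted original up to day \<open>l + P\<close>,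
  which is long enough for every interval that starts within the first period.\<close>

lemma periodic_pinwheel_schedule:
  assumes "pinwheel_schedule ps \<sigma>"
  obtains \<tau> l where "0 < l" "\<And>k. \<tau> (k + l) = \<tau> k" "pinwheel_schedule ps \<tau>"
proof -
  define P where "P = sum_list ps"
  have P: "ps ! j \<le> P" if "j < length ps" for j
    using that by (simp add: P_def elem_le_sum_list)
  have bnd: "\<sigma> k < length ps" for k
    using assms by (simp add: pinwheel_schedule_def)
  define f where "f t = map (\<lambda>i. \<sigma> (t + i)) [0..<Suc P]" for t
  have "range f \<subseteq> {xs. set xs \<subseteq> {..<length ps} \<and> length xs = Suc P}"
    by (auto simp: f_def bnd)
  then have "finite (range f)"
    by (rule finite_subset) (simp add: finite_lists_length_eq)
  then have "\<not> inj f"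
    using finite_imageD infinite_UNIV_nat by blast
  then obtain a b where ab: "a < b" "f a = f b"
    by (metis injI linorder_neqE_nat)
  have eq: "\<sigma> (a + i) = \<sigma> (b + i)" if "i \<le> P" for i
  proof -
    have "f a ! i = f b ! i" using ab by simp
    with that show ?thesis by (simp add: f_def del: upt_Suc)
  qed
  define l where "l = b - a"
  have l: "0 < l" using ab by (simp add: l_def)
  define \<tau> where "\<tau> k = \<sigma> (a + k mod l)" for k
  have per: "\<tau> (k + l) = \<tau> k" for k by (simp add: \<tau>_def)
  have unroll: "\<tau> k = \<sigma> (a + k)" if "k \<le> l + P" for k
    using that
  proof (induction k rule: less_induct)
    case (less k)
    show ?case
    proof (cases "k < l")
      case True
      then show ?thesis by (simp add: \<tau>_def)
    next
      case False
      then have "\<tau> k = \<tau> (k - l)" using per[of "k - l"] by simp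
      also have "\<dots> = \<sigma> (a + (k - l))" using less False l by simp
      also have "\<dots> = \<sigma> (b + (k - l))" using less.prems by (intro eq) simp
      also have "b + (k - l) = a + k" using False ab by (simp add: l_def)
      finally show ?thesis .
    qed
  qed
  have "j \<in> \<tau> ` {t + 1..t + ps ! j}" if j: "j < length ps" for t j
  proof -
    \<comment> \<open>By periodicity of \<open>\<tau>\<close> only \<open>t mod l\<close> matters,
      and the interval starting there ends no later than \<open>l + P\<close>, where
      \<open>unroll\<close> still applies.\<close>
    have "j \<in> \<sigma> ` {(a + t mod l) + 1..(a + t mod l) + ps ! j}"
      using assms j unfolding pinwheel_schedule_def by blast
    then obtain x where x: "x \<in> {(a + t mod l) + 1..(a + t mod l) + ps ! j}" "j = \<sigma> x"
      by blast
    define i where "i = x - (a + t mod l)"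
    have i: "1 \<le> i" "i \<le> ps ! j" "x = a + (t mod l + i)"
      using x(1) by (auto simp: i_def)
    have "t mod l + i \<le> l + P"
      using i(2) P[OF j] mod_less_divisor[OF l, of t] by linarith
    then have "\<tau> (t mod l + i) = j"
      using unroll i(3) x(2) by simp
    then have "\<tau> (t + i) = j"
      by (simp add: \<tau>_def mod_add_left_eq)
    then show ?thesis using i by (intro image_eqI[of _ _ "t + i"]) auto
  qed
  then have "pinwheel_schedule ps \<tau>"
    by (simp add: pinwheel_schedule_def \<tau>_def bnd)
  with that l per show thesis by blast
qed

section \<open>The reduction\<close>

text \<open>A vertex potential that vanishes at the two hubs \<open>0\<close> and \<open>2\<close>;
  it turns lengths of walks into sums over visited vertices.\<close>

definition spoke_cost :: "nat \<Rightarrow> nat" where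
  "spoke_cost v = (if v = 0 \<or> v = 2 then 0 else if v = 1 then 2 else 1)"

definition spoke_edges :: "nat \<Rightarrow> (nat \<times> nat \<times> rat) list" where
  "spoke_edges v = [(0, v, of_nat (spoke_cost v)), (2, v, of_nat (spoke_cost v))]"

text \<open>Clients have to be numbered consecutively from \<open>1\<close>, so job \<open>j\<close>
  becomes vertex \<open>j + 3\<close>. Edges are listed spoke by spoke, so that a machine can write
  them with a single counter.\<close>

definition reduction :: "nat list \<Rightarrow> rftt_input" where
  "reduction ps =
    \<lparr> turnovers = 1 # 1 # ps,
      edge_list = concat (map spoke_edges (1 # [3..<length ps + 3])),
      bound = 6 \<rparr>"

definition spokes :: "nat \<Rightarrow> nat set" where
  "spokes n = insert 1 {3..<n + 3}"

text \<open>For \<open>S\<close> disjoint from \<open>{0, 2}\<close> this is the complete bipartite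
  graph between the hubs and \<open>S\<close>.\<close>

definition bipartite_edges :: "nat set \<Rightarrow> nat set set" where
  "bipartite_edges S = (\<Union>v\<in>S. {{0, v}, {2, v}})"

section \<open>Series-parallel structure of the graph\<close>

lemma two_terminal_sp_path:
  assumes "a \<noteq> v" "v \<noteq> b" "a \<noteq> b"
  shows "two_terminal_sp {a, v, b} {{a, v}, {b, v}} a b"
proof -
  have "{a, v} \<inter> {v, b} = {v}" using assms by auto
  then have "two_terminal_sp ({a, v} \<union> {v, b}) ({{a, v}} \<union> {{v, b}}) a b"
    using assms by (blast intro: two_terminal_sp.series two_terminal_sp.edge)
  then show ?thesis by (simp add: insert_commute)
qed

text \<open>Each further spoke adds one path of length two in parallel between the terminals
  \<open>0\<close> and \<open>2\<close>; a single spoke is the base case.\<close>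

lemma series_parallel_bipartite:
  assumes "finite S" "S \<noteq> {}" "0 \<notin> S" "2 \<notin> S"
  shows "two_terminal_sp ({0, 2} \<union> S) (bipartite_edges S) 0 2"
  using assms
proof (induction S rule: finite_ne_induct)
  case (singleton v)
  then show ?case
    using two_terminal_sp_path[of 0 v 2] by (simp add: bipartite_edges_def insert_commute)
next
  case (insert v S)
  then have v: "two_terminal_sp {0, v, 2} {{0, v}, {2, v}} 0 2"
    by (intro two_terminal_sp_path) auto
  have IH: "two_terminal_sp ({0, 2} \<union> S) (bipartite_edges S) 0 2"
    using insert by simp
  have "{0, v, 2} \<inter> ({0, 2} \<union> S) = {0, 2}" using insert by auto
  moreover have "{{0, v}, {2, v}} \<inter> bipartite_edges S = {}"
    using insert by (auto simp: bipartite_edges_def doubleton_eq_iff)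
  ultimately have "two_terminal_sp ({0, v, 2} \<union> ({0, 2} \<union> S))
      ({{0, v}, {2, v}} \<union> bipartite_edges S) 0 2"
    by (rule two_terminal_sp.parallel[OF v IH])
  moreover have "{0, v, 2} \<union> ({0, 2} \<union> S) = {0, 2} \<union> insert v S"
    by auto
  moreover have "{{0, v}, {2, v}} \<union> bipartite_edges S = bipartite_edges (insert v S)"
    by (simp add: bipartite_edges_def)
  ultimately show ?case by simp
qed

section \<open>The components of the constructed instance\<close>

lemma weighted_edges_reduction:
  "weighted_edges (reduction ps) =
    concat (map (\<lambda>v. [({0, v}, of_nat (spoke_cost v)), ({2, v}, of_nat (spoke_cost v))])
      (1 # [3..<length ps + 3]))"
  by (simp add: weighted_edges_def reduction_def spoke_edges_def map_concat o_def)

text \<open>Hubs are never spokes, so distinct spokes yield distinct edges. Besides being required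
  of an instance, this makes \<open>map_of\<close> return the intended weight.\<close>

lemma distinct_weighted_edges: "distinct (map fst (weighted_edges (reduction ps)))"
proof -
  have "distinct (map fst (concat (map (\<lambda>v. [({0, v}, g v), ({2, v}, g v)]) vs)))"
    if "distinct vs" "0 \<notin> set vs" "2 \<notin> set vs" for vs :: "nat list" and g :: "nat \<Rightarrow> rat"
    using that by (induction vs) (auto simp: doubleton_eq_iff)
  from this[of "1 # [3..<length ps + 3]"] show ?thesis
    by (simp only: weighted_edges_reduction) auto
qed

lemma depot_reduction: "depot (rftt_of (reduction ps)) = 0"
  by (simp add: rftt_of_def)

lemma clients_reduction: "clients (rftt_of (reduction ps)) = insert 2 (spokes (length ps))"
  by (auto simp: rftt_of_def reduction_def spokes_def)

lemma verts_reduction: "verts (rftt_of (reduction ps)) = {0, 2} \<union> spokes (length ps)"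
  by (auto simp: verts_def depot_reduction clients_reduction)

lemma edges_reduction: "edges (rftt_of (reduction ps)) = bipartite_edges (spokes (length ps))"
proof -
  have "fst ` set (concat (map (\<lambda>v. [({0, v}, g v), ({2, v}, g v)]) vs)) = bipartite_edges (set vs)"
    for vs and g :: "nat \<Rightarrow> rat"
    by (induction vs) (auto simp: bipartite_edges_def)
  moreover have "set (1 # [3..<length ps + 3]) = spokes (length ps)"
    by (simp add: spokes_def)
  ultimately show ?thesis
    unfolding rftt_of_def weighted_edges_reduction by (simp only: rftt.simps)
qed

lemma turnover_reduction:
  "turnover (rftt_of (reduction ps)) v =
    (if v \<le> 2 then 1 else ps ! (v - 3))"
proof -
  \<comment> \<open>For the depot the index \<open>v - 1\<close> truncates to \<open>0\<close>, so
    it reads the first entry, which is \<open>1\<close>.\<close>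
  have "v = 0 \<or> v = 1 \<or> v = 2 \<or> (\<exists>i. v = Suc (Suc (Suc i)))" by presburger
  then show ?thesis by (auto simp: rftt_of_def reduction_def)
qed

lemma weight_spoke:
  assumes "v \<in> spokes (length ps)" "h = 0 \<or> h = 2"
  shows "weight (rftt_of (reduction ps)) {h, v} = real (spoke_cost v)"
proof -
  have "({h, v}, of_nat (spoke_cost v)) \<in> set (weighted_edges (reduction ps))"
    using assms unfolding weighted_edges_reduction by (auto simp: spokes_def)
  then have "map_of (weighted_edges (reduction ps)) {h, v} = Some (of_nat (spoke_cost v))"
    using distinct_weighted_edges by (simp add: map_of_is_SomeI)
  then show ?thesis by (simp add: rftt_of_def)
qed

lemma adjacent_iff:
  "{u, v} \<in> edges (rftt_of (reduction ps)) \<longleftrightarrow>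
    u \<in> {0, 2} \<and> v \<in> spokes (length ps) \<or> v \<in> {0, 2} \<and> u \<in> spokes (length ps)"
  unfolding edges_reduction bipartite_edges_def by (auto simp: doubleton_eq_iff)

text \<open>One end of each edge is a hub of cost \<open>0\<close>. Adding both costs gives a
  symmetric formula, which spares walks the distinction between the two directions.\<close>

lemma weight_reduction:
  assumes "{u, v} \<in> edges (rftt_of (reduction ps))"
  shows "weight (rftt_of (reduction ps)) {u, v} = real (spoke_cost u + spoke_cost v)"
proof -
  have "weight (rftt_of (reduction ps)) {u, v} = real (spoke_cost v)" "spoke_cost u = 0"
    if "u \<in> {0, 2}" "v \<in> spokes (length ps)" for u v
    using that weight_spoke[of v ps u] by (auto simp: spoke_cost_def)
  from this[of u v] this[of v u] show ?thesis
    using assms unfolding adjacent_iff by (auto simp: insert_commute[of u v])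
qed

lemma reduction_instance:
  assumes "\<forall>p \<in> set ps. 0 < p"
  shows "reduction ps \<in> instances min_avg_rftt_series_parallel"
proof -
  let ?I = "rftt_of (reduction ps)" and ?S = "spokes (length ps)"
  have S: "finite ?S" "?S \<noteq> {}" "0 \<notin> ?S" "2 \<notin> ?S" "1 \<in> ?S"
    by (auto simp: spokes_def)
  have "graph (verts ?I) (edges ?I)"
    unfolding graph_def verts_reduction edges_reduction bipartite_edges_def
    using S(1,3,4) by fastforce
  moreover have "connected_graph (verts ?I) (edges ?I)"
    unfolding connected_graph_def
  proof (intro ballI)
    fix u v assume uv: "u \<in> verts ?I" "v \<in> verts ?I"
    \<comment> \<open>Two spokes meet via the depot, a hub and a spoke are adjacent, and two hubs
      meet via vertex \<open>1\<close>, which is a spoke even if there are no jobs.\<close>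
    define w where "w = (if u \<in> ?S \<and> v \<in> ?S then [u, 0, v]
      else if u \<in> ?S \<or> v \<in> ?S then [u, v] else [u, 1, v])"
    have "walk (verts ?I) (edges ?I) w"
      using uv S by (auto simp: w_def walk_def adjacent_iff verts_reduction)
    then show "\<exists>w. walk (verts ?I) (edges ?I) w \<and> hd w = u \<and> last w = v"
      by (intro exI[of _ w]) (auto simp: w_def)
  qed
  moreover have "0 \<le> weight ?I e" if "e \<in> edges ?I" for e
  proof -
    from that obtain h v where "e = {h, v}" "v \<in> ?S" "h = 0 \<or> h = 2"
      unfolding edges_reduction bipartite_edges_def by auto
    then show ?thesis using weight_spoke by simp
  qed
  moreover have "0 < turnover ?I v" if "v \<in> clients ?I" for v
    using that assms by (auto simp: turnover_reduction clients_reduction spokes_def)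
  ultimately have "is_rftt ?I"
    using S by (simp add: is_rftt_def depot_reduction clients_reduction)
  moreover have "series_parallel (verts ?I) (edges ?I)"
    unfolding series_parallel_def verts_reduction edges_reduction
    using series_parallel_bipartite S by blast
  ultimately show ?thesis
    using distinct_weighted_edges
    by (simp add: min_avg_rftt_series_parallel_def min_avg_rftt_def reduction_def)
qed

text \<open>
  Every edge weighs as much as its two ends together, so a tour pays twice for each vertex
  occurrence.
\<close>

lemma walk_length:
  assumes "successively (\<lambda>u v. {u, v} \<in> edges (rftt_of (reduction ps))) w" "w \<noteq> []"
  shows "tour_length (rftt_of (reduction ps)) w + real (spoke_cost (hd w))
    + real (spoke_cost (last w)) = 2 * real (\<Sum>v\<leftarrow>w. spoke_cost v)"
  using assms
proof (induction w rule: induct_list012)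
  case (3 u v w)
  then show ?case by (simp add: tour_length_def weight_reduction)
qed (simp_all add: tour_length_def)

text \<open>Both ends are the depot, of cost \<open>0\<close>, so the boundary terms of
  \<open>walk_length\<close> vanish.\<close>

lemma tour_length_reduction:
  assumes "tour (rftt_of (reduction ps)) w"
  shows "tour_length (rftt_of (reduction ps)) w = 2 * real (\<Sum>v\<leftarrow>w. spoke_cost v)"
  using walk_length[of ps w] assms
  by (simp add: tour_def walk_def depot_reduction spoke_cost_def)

section \<open>Cost of the vertices on a tour\<close>

lemma sum_list_nat_ge_sum_set: "sum f (set xs) \<le> sum_list (map f xs)" for f :: "'a \<Rightarrow> nat"
  by (induction xs) (auto simp: sum.insert_if)

text \<open>Vertex \<open>2\<close> is not the depot, so it has a predecessor and a successor on the
  tour, and all its neighbours are spokes.\<close>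

lemma tour_split:
  assumes "tour (rftt_of (reduction ps)) w" "2 \<in> set w"
  obtains xs a b ys where "w = xs @ a # 2 # b # ys" "a \<in> spokes (length ps)" "b \<in> spokes (length ps)"
proof -
  from assms(2) obtain us vs where w: "w = us @ 2 # vs" by (meson split_list)
  have "us \<noteq> []" "vs \<noteq> []"
    using assms(1) by (auto simp: tour_def depot_reduction w)
  then obtain xs a b ys where "us = xs @ [a]" "vs = b # ys"
    by (meson neq_Nil_conv rev_exhaust)
  then have "w = xs @ a # 2 # b # ys" by (simp add: w)
  moreover from this have "{a, 2} \<in> edges (rftt_of (reduction ps))"
      "{2, b} \<in> edges (rftt_of (reduction ps))"
    using assms(1) by (simp_all add: tour_def walk_def successively_append_iff)
  ultimately show ?thesis
    using that by (auto simp: adjacent_iff spokes_def)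
qed

text \<open>Vertex \<open>1\<close>, of cost 2, occurs before or after the chosen visit to
  \<open>2\<close>. The neighbour of \<open>2\<close> on the other side is a separate occurrence of
  a spoke and costs at least 1 more.\<close>

lemma tour_cost_ge:
  assumes "tour (rftt_of (reduction ps)) w" "1 \<in> set w" "2 \<in> set w"
  shows "3 \<le> (\<Sum>v\<leftarrow>w. spoke_cost v)"
proof -
  obtain xs a b ys where w: "w = xs @ a # 2 # b # ys"
      "a \<in> spokes (length ps)" "b \<in> spokes (length ps)"
    using tour_split assms by blast
  have ab: "1 \<le> spoke_cost a" "1 \<le> spoke_cost b"
    using w by (auto simp: spoke_cost_def spokes_def)
  have one: "spoke_cost 1 = 2" by (simp add: spoke_cost_def)
  have "2 \<le> (\<Sum>v\<leftarrow>zs. spoke_cost v)" if "1 \<in> set zs" for zs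
    using member_le_sum_list[of "spoke_cost 1" "map spoke_cost zs"] that one
    by force
  from this[of "xs @ [a]"] this[of "b # ys"] have
    "2 \<le> (\<Sum>v\<leftarrow>xs @ [a]. spoke_cost v) \<or> 2 \<le> (\<Sum>v\<leftarrow>b # ys. spoke_cost v)"
    using assms(2) unfolding w by auto
  then show ?thesis using ab unfolding w by auto
qed

lemma cheap_tour:
  assumes "tour (rftt_of (reduction ps)) w" "1 \<in> set w" "2 \<in> set w"
    and "(\<Sum>v\<leftarrow>w. spoke_cost v) \<le> 3"
  shows "\<exists>v. set w \<inter> {3..<length ps + 3} = {v}"
proof -
  obtain xs a b ys where w: "w = xs @ a # 2 # b # ys"
      "a \<in> spokes (length ps)" "b \<in> spokes (length ps)"
    using tour_split assms by blast
  \<comment> \<open>Entering and leaving \<open>2\<close> through vertex \<open>1\<close> would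
    already cost 4.\<close>
  have "a \<noteq> 1 \<or> b \<noteq> 1"
    using assms(4) unfolding w by (auto simp: spoke_cost_def)
  then obtain v where v: "v \<in> set w \<inter> {3..<length ps + 3}"
    using w by (auto simp: spokes_def)
  have unique: "u = v" if "u \<in> set w" "v \<in> set w" "3 \<le> u" "3 \<le> v" for u v
  proof (rule ccontr)
    assume "u \<noteq> v"
    \<comment> \<open>Vertex \<open>1\<close> together with two different jobs exceeds the budget of
      3.\<close>
    then have "sum spoke_cost {1, u, v} = 4"
      using that by (simp add: spoke_cost_def)
    moreover have "sum spoke_cost {1, u, v} \<le> sum spoke_cost (set w)"
      using that assms(2) by (intro sum_mono2) auto
    ultimately show False
      using sum_list_nat_ge_sum_set[of spoke_cost w] assms(4) by linarith
  qed
  have "set w \<inter> {3..<length ps + 3} = {v}"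
    using v by (auto intro: unique)
  then show ?thesis ..
qed

section \<open>Correctness of the reduction\<close>

lemma reduction_complete:
  assumes "pinwheel_schedule ps \<sigma>"
  shows "min_avg_at_most (rftt_of (reduction ps)) 6"
proof -
  let ?I = "rftt_of (reduction ps)"
  from assms obtain \<tau> l where l: "0 < l" and per: "\<And>k. \<tau> (k + l) = \<tau> k"
    and sched: "pinwheel_schedule ps \<tau>"
    by (rule periodic_pinwheel_schedule) blast
  have bnd: "\<tau> k < length ps" for k
    using sched by (simp add: pinwheel_schedule_def)
  \<comment> \<open>Out along the path through \<open>1\<close> and back through the scheduled job:
    the cost is \<open>2 + 1\<close>, hence the length is 6.\<close>
  define T where "T k = [0, 1, 2, \<tau> k + 3, 0]" for k
  define J where "J k = {1, 2, \<tau> k + 3}" for k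
  have tour: "tour ?I (T k)" for k
    using bnd[of k]
    by (auto simp: tour_def walk_def T_def adjacent_iff depot_reduction verts_reduction spokes_def)
  have len: "tour_length ?I (T k) = 6" for k
    using tour_length_reduction[OF tour[of k]] by (simp add: T_def spoke_cost_def)
  have "v \<in> (\<Union>k \<in> {t + 1..t + turnover ?I v}. J k)" if v: "v \<in> clients ?I" for t v
  proof (cases "v \<le> 2")
    case True
    with v have "v = 1 \<or> v = 2" by (auto simp: clients_reduction spokes_def)
    with True show ?thesis by (auto simp: turnover_reduction J_def)
  next
    case False
    define j where "j = v - 3"
    have j: "v = j + 3" "j < length ps"
      using False v by (auto simp: clients_reduction spokes_def j_def)
    have "j \<in> \<tau> ` {t + 1..t + ps ! j}"
      using sched j by (simp add: pinwheel_schedule_def)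
    then obtain k where k: "k \<in> {t + 1..t + ps ! j}" "j = \<tau> k" by blast
    then have "v \<in> J k" using j by (simp add: J_def)
    then show ?thesis using k j by (auto simp: turnover_reduction)
  qed
  moreover have "J k \<subseteq> clients ?I \<inter> set (T k)" for k
    using bnd[of k] by (auto simp: J_def T_def clients_reduction spokes_def)
  ultimately have "feasible ?I T J"
    using tour by (simp add: feasible_def)
  moreover have "has_period T J l"
    using l per by (simp add: has_period_def T_def J_def)
  moreover have "average_length ?I T l \<le> 6"
    using l by (simp add: average_length_def len)
  ultimately show ?thesis unfolding min_avg_at_most_def by blast
qed

text \<open>Turnover time \<open>1\<close> puts vertices \<open>1\<close> and \<open>2\<close> on
  every tour, so no day is shorter than 6. An average of at most 6 then makes every day exactly 6
  long, and \<open>cheap_tour\<close> picks out the one job of the day.\<close>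

lemma reduction_sound:
  assumes "min_avg_at_most (rftt_of (reduction ps)) 6"
  shows "\<exists>\<sigma>. pinwheel_schedule ps \<sigma>"
proof -
  let ?I = "rftt_of (reduction ps)"
  obtain T J l where feas: "feasible ?I T J" and per: "has_period T J l"
    and avg: "average_length ?I T l \<le> 6"
    using assms unfolding min_avg_at_most_def by blast
  have tour: "tour ?I (T k)" and J: "J k \<subseteq> clients ?I \<inter> set (T k)" if "1 \<le> k" for k
    using feas that by (auto simp: feasible_def)
  have cov: "v \<in> (\<Union>k \<in> {t + 1..t + turnover ?I v}. J k)" if "v \<in> clients ?I" for t v
    using feas that unfolding feasible_def by blast
  have daily: "1 \<in> set (T k)" "2 \<in> set (T k)" if k: "1 \<le> k" for k
  proof -
    have "v \<in> set (T k)" if "v = 1 \<or> v = 2" for v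
    proof -
      \<comment> \<open>The window of length one after day \<open>k - 1\<close> is day
        \<open>k\<close> itself.\<close>
      have "v \<in> J k"
        using cov[of v "k - 1"] that k
        by (auto simp: turnover_reduction clients_reduction spokes_def)
      then show ?thesis using J[OF k] by blast
    qed
    then show "1 \<in> set (T k)" "2 \<in> set (T k)" by simp_all
  qed
  define c where "c k = (\<Sum>v\<leftarrow>T k. spoke_cost v)" for k
  have len: "tour_length ?I (T k) = 2 * real (c k)" if "1 \<le> k" for k
    using tour_length_reduction[OF tour[OF that]] by (simp add: c_def)
  have ge: "3 \<le> c k" if "1 \<le> k" for k
    unfolding c_def using tour_cost_ge tour daily that by blast
  have l: "1 \<le> l" using per by (simp add: has_period_def)
  have "(\<Sum>k = 1..l. tour_length ?I (T k)) = 2 * real (\<Sum>k = 1..l. c k)"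
    by (simp add: len sum_distrib_left)
  then have "real (\<Sum>k = 1..l. c k) \<le> real (3 * l)"
    using avg l by (simp add: average_length_def field_simps)
  then have sum_le: "(\<Sum>k = 1..l. c k) \<le> 3 * l"
    by (simp only: of_nat_le_iff)
  have first: "c k \<le> 3" if k: "k \<in> {1..l}" for k
  proof (rule ccontr)
    assume "\<not> c k \<le> 3"
    \<comment> \<open>One day of cost above 3 would push the sum over the period above
      \<open>3 * l\<close>, as no day costs less than 3.\<close>
    then have "(\<Sum>k = 1..l. 3) < (\<Sum>k = 1..l. c k)"
      using k ge by (intro sum_strict_mono_ex1) (auto intro!: bexI[of _ k])
    then show False using sum_le by simp
  qed
  have cheap: "c k \<le> 3" if "1 \<le> k" for k
    using that
  proof (induction k rule: less_induct)
    case (less k)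
    show ?case
    proof (cases "k \<le> l")
      case True
      then show ?thesis using first less.prems by simp
    next
      case False
      then have "T k = T (k - l)"
        using per[unfolded has_period_def, THEN conjunct2, rule_format, of "k - l"] by simp
      then show ?thesis using less.IH[of "k - l"] False l by (simp add: c_def)
    qed
  qed
  have "\<exists>v. set (T k) \<inter> {3..<length ps + 3} = {v}" if "1 \<le> k" for k
    using cheap_tour tour daily cheap that unfolding c_def by blast
  then obtain \<nu> where \<nu>: "set (T k) \<inter> {3..<length ps + 3} = {\<nu> k}" if "1 \<le> k" for k
    by metis
  \<comment> \<open>Day \<open>0\<close> has no tour but needs a valid job index, so it borrows the
    job of day \<open>1\<close>. Subtracting 3 turns the vertex label into a job index.\<close>
  define \<sigma> where "\<sigma> k = \<nu> (max 1 k) - 3" for k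
  have "\<nu> (max 1 k) \<in> {3..<length ps + 3}" for k
    using \<nu>[of "max 1 k"] by auto
  then have "\<sigma> k < length ps" for k
    unfolding \<sigma>_def by (metis atLeastLessThan_iff less_diff_conv2)
  moreover have "j \<in> \<sigma> ` {t + 1..t + ps ! j}" if j: "j < length ps" for t j
  proof -
    have "j + 3 \<in> (\<Union>k \<in> {t + 1..t + turnover ?I (j + 3)}. J k)"
      using j by (intro cov) (simp add: clients_reduction spokes_def)
    then obtain k where k: "k \<in> {t + 1..t + ps ! j}" "j + 3 \<in> J k"
      by (auto simp: turnover_reduction)
    then have "j + 3 \<in> set (T k) \<inter> {3..<length ps + 3}"
      using J[of k] j by auto
    moreover have "set (T k) \<inter> {3..<length ps + 3} = {\<nu> k}"
      using k by (intro \<nu>) simp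
    ultimately have "j + 3 = \<nu> k" by blast
    then have "\<sigma> k = j" using k by (simp add: \<sigma>_def max_def)
    then show ?thesis using k by blast
  qed
  ultimately show ?thesis unfolding pinwheel_schedule_def by blast
qed

section \<open>Turing machine programs\<close>

text \<open>
  A tape holding \<open>rev u @ v\<close> from cell \<open>0\<close> on, with the head on the first symbol of \<open>v\<close> or,
  for \<open>tape_before\<close>, one cell further left.
\<close>

definition tape_at :: "symbol list \<Rightarrow> symbol list \<Rightarrow> tape" where
  "tape_at u v = (string_tape (rev u @ v), int (length u))"

definition tape_before :: "symbol list \<Rightarrow> symbol list \<Rightarrow> tape" where
  "tape_before u v = (string_tape (rev u @ v), int (length u) - 1)"

definition read :: "tape \<Rightarrow> symbol option" where
  "read T = fst T (snd T)"

section \<open>Symbolic tapes\<close>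

lemma string_tape_nth: "string_tape (u @ x # v) (int (length u)) = Some x"
  by (simp add: string_tape_def)

lemma string_tape_end: "string_tape u (int (length u)) = None"
  by (simp add: string_tape_def)

lemma string_tape_update:
  "(string_tape (u @ x # v))(int (length u) := Some y) = string_tape (u @ y # v)"
  by (rule ext) (auto simp: string_tape_def nth_append nth_Cons split: nat.splits)

lemma string_tape_append:
  "(string_tape u)(int (length u) := Some y) = string_tape (u @ [y])"
  by (rule ext) (auto simp: string_tape_def nth_append nth_Cons split: nat.splits)

text \<open>With \<open>act_tape\<close>, these rules let the simplifier run instructions on tapes
  in symbolic form, without unfolding cell contents.\<close>

lemma read_tape [simp]:
  "read (tape_at u (x # v)) = Some x"
  "read (tape_at u []) = None"
  "read (tape_before (x # u) v) = Some x"
  "read (tape_before [] v) = None"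
  using string_tape_nth[of "rev u" x v] string_tape_end[of "rev u"]
  by (simp_all add: read_def tape_at_def tape_before_def) (simp add: string_tape_def)

lemma act_tape [simp]:
  "act (Some y, Move_Right) (tape_at u (x # v)) = tape_at (y # u) v"
  "act (Some y, Move_Right) (tape_at u []) = tape_at (y # u) []"
  "act (Some y, Move_Left) (tape_at u (x # v)) = tape_before u (y # v)"
  "act (Some y, Move_Left) (tape_at u []) = tape_before u [y]"
  "act (None, Move_Left) (tape_at u []) = tape_before u []"
  "act (Some x, Move_Left) (tape_before (x # u) v) = tape_before u (x # v)"
  "act (None, Move_Right) (tape_before [] v) = tape_at [] v"
  using string_tape_update[of "rev u" x v y] string_tape_append[of "rev u" y]
    string_tape_update[of "rev u" x v x] string_tape_end[of "rev u"]
  by (simp_all add: tape_at_def tape_before_def fun_upd_idem) (simp add: string_tape_def fun_upd_idem)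

lemma act_read: "act (read T, Stay) T = T"
  by (cases T) (simp add: read_def)

text \<open>Writing back the scanned symbols without moving is the neutral action; instructions
  override it on the tapes they work on.\<close>

definition idle :: "symbol option list \<Rightarrow> (symbol option \<times> move) list" where
  "idle rs = map (\<lambda>r. (r, Stay)) rs"

lemma length_idle [simp]: "length (idle rs) = length rs"
  by (simp add: idle_def)

lemma map2_act_idle: "map2 act (idle (map read ts)) ts = ts"
  by (rule nth_equalityI) (simp_all add: idle_def act_read)

lemma map2_act_update:
  assumes "length as = length ts"
  shows "map2 act (as[i := a]) ts = (map2 act as ts)[i := act a (ts ! i)]"
  using assms by (cases "i < length ts") (auto intro!: nth_equalityI simp: nth_list_update)

section \<open>The instruction set\<close>

type_synonym instr = "symbol option list \<Rightarrow> nat \<times> (symbol option \<times> move) list"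

definition put :: "nat \<Rightarrow> symbol \<Rightarrow> move \<Rightarrow> nat \<Rightarrow> instr" where
  "put i x m q' rs = (q', (idle rs)[i := (Some x, m)])"

text \<open>Here and in the scanning instructions below, \<open>q\<close> is meant to be the
  instruction's own address, so that going to \<open>q\<close> repeats it, and \<open>q'\<close> is
  an exit.\<close>

definition rewind :: "nat \<Rightarrow> nat \<Rightarrow> nat \<Rightarrow> instr" where
  "rewind i q q' rs = (case rs ! i of
      None \<Rightarrow> (q', (idle rs)[i := (None, Move_Right)])
    | Some x \<Rightarrow> (q, (idle rs)[i := (Some x, Move_Left)]))"

definition forward :: "nat \<Rightarrow> nat \<Rightarrow> nat \<Rightarrow> instr" where
  "forward i q q' rs = (case rs ! i of
      None \<Rightarrow> (q', idle rs)
    | Some x \<Rightarrow> (q, (idle rs)[i := (Some x, Move_Right)]))"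

text \<open>With the least significant bit first, the carry moves right over ones until it meets a
  zero or the blank. The final move to the left prepares for \<open>rewind\<close>.\<close>

definition increment :: "nat \<Rightarrow> nat \<Rightarrow> nat \<Rightarrow> instr" where
  "increment i q q' rs = (if rs ! i = Some (Bit True)
    then (q, (idle rs)[i := (Some (Bit False), Move_Right)])
    else (q', (idle rs)[i := (Some (Bit True), Move_Left)]))"

definition copy :: "nat \<Rightarrow> nat \<Rightarrow> nat \<Rightarrow> instr" where
  "copy i q q' rs = (case rs ! i of
      None \<Rightarrow> (q', (idle rs)[i := (None, Move_Left)])
    | Some x \<Rightarrow> (q, (idle rs)[i := (Some x, Move_Right), 1 := (Some x, Move_Right)]))"

text \<open>Passes over one number: exit \<open>q'\<close> is taken behind its separator, exit
  \<open>q''\<close> at the end of the input.\<close>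

definition next_sep :: "nat \<Rightarrow> nat \<Rightarrow> nat \<Rightarrow> instr" where
  "next_sep q q' q'' rs = (case rs ! 0 of
      None \<Rightarrow> (q'', (idle rs)[0 := (None, Move_Left)])
    | Some x \<Rightarrow> (if x = Sep then q' else q, (idle rs)[0 := (Some x, Move_Right)]))"

section \<open>Executions with time bounds\<close>

definition has_instr :: "tm \<Rightarrow> nat \<Rightarrow> instr \<Rightarrow> bool" where
  "has_instr M q ins \<longleftrightarrow> q \<noteq> nstates M \<and> delta M q = ins"

declare step.simps [simp del]

lemma step_instr:
  assumes "has_instr M q ins"
  shows "step M (q, ts) = (fst (ins (map read ts)), map2 act (snd (ins (map read ts))) ts)"
proof -
  have "(\<lambda>(f, h). f h) = (read :: tape \<Rightarrow> _)"
    by (rule ext) (simp add: read_def split_beta)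
  then show ?thesis
    using assms by (simp add: step.simps has_instr_def split_beta Let_def)
qed

text \<open>The time is an upper bound, so that it can be relaxed by \<open>reaches_mono\<close>; in
  calculations the bounds of consecutive runs add up.\<close>

definition reaches :: "tm \<Rightarrow> nat \<Rightarrow> config \<Rightarrow> config \<Rightarrow> bool" where
  "reaches M t c c' \<longleftrightarrow> (\<exists>k\<le>t. (step M ^^ k) c = c')"

lemma reaches_refl: "reaches M 0 c c"
  by (simp add: reaches_def)

lemma reaches_step: "step M c = c' \<Longrightarrow> reaches M (Suc 0) c c'"
  unfolding reaches_def by (intro exI[of _ 1]) simp

lemma reaches_trans [trans]:
  assumes "reaches M s c c'" "reaches M t c' c''"
  shows "reaches M (s + t) c c''"
proof -
  obtain j k where "j \<le> s" "(step M ^^ j) c = c'" "k \<le> t" "(step M ^^ k) c' = c''"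
    using assms by (auto simp: reaches_def)
  then show ?thesis
    unfolding reaches_def by (intro exI[of _ "k + j"]) (simp add: funpow_add)
qed

lemma reaches_Suc: "step M c = c' \<Longrightarrow> reaches M t c' c'' \<Longrightarrow> reaches M (Suc t) c c''"
  using reaches_trans[OF reaches_step, of M c c' t c''] by simp

lemma reaches_mono: "reaches M s c c' \<Longrightarrow> s \<le> t \<Longrightarrow> reaches M t c c'"
  unfolding reaches_def using order.trans by blast

text \<open>A halting configuration is a fixed point of \<open>step\<close>, so the steps left over
  after an early halt change nothing.\<close>

lemma outputs_within_reaches:
  assumes "reaches M t (initial_config M xs) (nstates M, ts)" "fst (ts ! 1) = string_tape ys"
  shows "outputs_within M xs ys t"
proof -
  obtain k where k: "k \<le> t" "(step M ^^ k) (initial_config M xs) = (nstates M, ts)"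
    using assms(1) by (auto simp: reaches_def)
  have "(step M ^^ j) (nstates M, ts) = (nstates M, ts)" for j
    by (induction j) (simp_all add: step.simps)
  then have "(step M ^^ (t - k + k)) (initial_config M xs) = (nstates M, ts)"
    unfolding funpow_add using k by simp
  then show ?thesis
    using k(1) assms(2) by (simp add: outputs_within_def)
qed

section \<open>Running times of the instructions\<close>

lemma reaches_put_right:
  assumes "has_instr M q (put i x Move_Right q')" "i < length ts" "ts ! i = tape_at u []"
  shows "reaches M 1 (q, ts) (q', ts[i := tape_at (x # u) []])"
  using assms(2,3)
  by (auto intro!: reaches_step simp: step_instr[OF assms(1)] put_def map2_act_update map2_act_idle)

lemma reaches_put_left:
  assumes "has_instr M q (put i x Move_Left q')" "i < length ts" "ts ! i = tape_at u []"
  shows "reaches M 1 (q, ts) (q', ts[i := tape_before u [x]])"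
  using assms(2,3)
  by (auto intro!: reaches_step simp: step_instr[OF assms(1)] put_def map2_act_update map2_act_idle)

lemma reaches_rewind:
  assumes "has_instr M q (rewind i q q')" "i < length ts" "ts ! i = tape_before u v"
  shows "reaches M (length u + 1) (q, ts) (q', ts[i := tape_at [] (rev u @ v)])"
  using assms(2,3)
proof (induction u arbitrary: v ts)
  case Nil
  then have "step M (q, ts) = (q', ts[i := tape_at [] v])"
    by (simp add: step_instr[OF assms(1)] rewind_def map2_act_update map2_act_idle)
  then show ?case by (simp add: reaches_step)
next
  case (Cons x u)
  then have "step M (q, ts) = (q, ts[i := tape_before u (x # v)])"
    by (simp add: step_instr[OF assms(1)] rewind_def map2_act_update map2_act_idle)
  moreover have "reaches M (length u + 1) (q, ts[i := tape_before u (x # v)])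
      (q', ts[i := tape_at [] (rev u @ x # v)])"
    using Cons.IH[of "ts[i := tape_before u (x # v)]" "x # v"] Cons.prems by simp
  ultimately show ?case by (auto dest: reaches_Suc)
qed

lemma reaches_forward:
  assumes "has_instr M q (forward i q q')" "i < length ts" "ts ! i = tape_at u v"
  shows "reaches M (length v + 1) (q, ts) (q', ts[i := tape_at (rev v @ u) []])"
  using assms(2,3)
proof (induction v arbitrary: u ts)
  case Nil
  then have "step M (q, ts) = (q', ts)"
    by (simp add: step_instr[OF assms(1)] forward_def map2_act_idle)
  moreover have "ts[i := tape_at u []] = ts"
    using Nil by (metis list_update_id)
  ultimately show ?case by (simp add: reaches_step)
next
  case (Cons x v)
  then have "step M (q, ts) = (q, ts[i := tape_at (x # u) v])"
    by (simp add: step_instr[OF assms(1)] forward_def map2_act_update map2_act_idle)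
  moreover have "reaches M (length v + 1) (q, ts[i := tape_at (x # u) v])
      (q', ts[i := tape_at (rev v @ x # u) []])"
    using Cons.IH[of "ts[i := tape_at (x # u) v]" "x # u"] Cons.prems by simp
  ultimately show ?case by (auto dest: reaches_Suc)
qed

lemma reaches_copy:
  assumes "has_instr M q (copy i q q')" "i \<noteq> 1" "i < length ts" "1 < length ts"
    and "ts ! i = tape_at u v" "ts ! 1 = tape_at w []"
  shows "reaches M (length v + 1) (q, ts)
    (q', ts[i := tape_before (rev v @ u) [], 1 := tape_at (rev v @ w) []])"
  using assms(3-)
proof (induction v arbitrary: u w ts)
  case Nil
  then have "step M (q, ts) = (q', ts[i := tape_before u []])"
    by (simp add: step_instr[OF assms(1)] copy_def map2_act_update map2_act_idle)
  moreover have "ts[i := tape_before u [], 1 := tape_at w []] = ts[i := tape_before u []]"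
    using Nil assms(2) by (metis list_update_id list_update_swap)
  ultimately show ?case by (simp add: reaches_step)
next
  case (Cons x v)
  let ?ts = "ts[i := tape_at (x # u) v, 1 := tape_at (x # w) []]"
  have "step M (q, ts) = (q, ?ts)"
    using Cons.prems
    by (simp add: step_instr[OF assms(1)] copy_def map2_act_update map2_act_idle)
  moreover have "reaches M (length v + 1) (q, ?ts)
      (q', ?ts[i := tape_before (rev v @ x # u) [], 1 := tape_at (rev v @ x # w) []])"
    using Cons.IH[of ?ts "x # u" "x # w"] Cons.prems assms(2) by simp
  moreover have "?ts[i := tape_before (rev v @ x # u) [], 1 := tape_at (rev v @ x # w) []]
      = ts[i := tape_before (rev v @ x # u) [], 1 := tape_at (rev v @ x # w) []]"
    using assms(2) Cons.prems by (auto intro!: nth_equalityI simp: nth_list_update)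
  ultimately show ?case by (auto dest: reaches_Suc)
qed

lemma reaches_puts:
  assumes "\<And>j. j < length xs \<Longrightarrow> has_instr M (q + j) (put 1 (xs ! j) Move_Right (Suc (q + j)))"
    and "1 < length ts" "ts ! 1 = tape_at w []"
  shows "reaches M (length xs) (q, ts) (q + length xs, ts[1 := tape_at (rev xs @ w) []])"
  using assms
proof (induction xs arbitrary: q w ts)
  case Nil
  then have "ts[1 := tape_at w []] = ts" by (metis list_update_id)
  then show ?case by (simp add: reaches_refl)
next
  case (Cons x xs)
  let ?ts = "ts[1 := tape_at (x # w) []]"
  have "reaches M 1 (q, ts) (Suc q, ?ts)"
    using Cons.prems(1)[of 0] Cons.prems(2,3) by (intro reaches_put_right) simp_all
  moreover have "reaches M (length xs) (Suc q, ?ts)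
      (Suc q + length xs, ?ts[1 := tape_at (rev xs @ x # w) []])"
  proof (rule Cons.IH)
    show "has_instr M (Suc q + j) (put 1 (xs ! j) Move_Right (Suc (Suc q + j)))"
      if "j < length xs" for j
      using Cons.prems(1)[of "Suc j"] that by simp
  qed (use Cons.prems in simp_all)
  ultimately show ?case by (auto dest: reaches_trans)
qed

fun bits_succ :: "bool list \<Rightarrow> bool list" where
  "bits_succ [] = [True]"
| "bits_succ (False # bs) = True # bs"
| "bits_succ (True # bs) = False # bits_succ bs"

text \<open>For even \<open>n\<close> only the lowest bit changes; for odd \<open>n\<close> it
  becomes zero and the carry increments \<open>n div 2\<close>.\<close>

lemma binary_Suc: "binary (Suc n) = bits_succ (binary n)"
proof (induction n rule: less_induct)
  case (less n)
  show ?case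
  proof (cases "n = 0 \<or> even n")
    case True
    then show ?thesis
      by (cases "n = 0") (simp_all add: binary.simps[of "Suc n"] binary.simps[of n] binary.simps[of 0] binary.simps[of "Suc 0"])
  next
    case False
    then have "binary (Suc (n div 2)) = bits_succ (binary (n div 2))"
      by (intro less) (cases n, auto)
    moreover have "Suc n div 2 = Suc (n div 2)" using False by presburger
    ultimately show ?thesis
      using False by (simp add: binary.simps[of "Suc n"] binary.simps[of n])
  qed
qed

text \<open>This crude bound suffices because it is applied only to counters, whose values stay
  within the number of periods plus 2.\<close>

lemma length_binary: "length (binary n) \<le> n"
proof (induction n rule: less_induct)
  case (less n)
  show ?case
  proof (cases "n = 0")
    case False
    then have "length (binary (n div 2)) \<le> n div 2" by (intro less) simp
    moreover have "n div 2 < n" using False by simp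
    ultimately show ?thesis
      using False by (subst binary.simps) simp
  qed (simp add: binary.simps)
qed

abbreviation bits :: "nat \<Rightarrow> symbol list" where
  "bits n \<equiv> map Bit (binary n)"

text \<open>The list \<open>u\<close> holds the cells already passed by the carry. Each bit of
  \<open>bs\<close> costs at most one step out and one step back, and each cell of \<open>u\<close>
  one step back.\<close>

lemma reaches_increment_bits:
  assumes "has_instr M q (increment i q q')" "has_instr M q' (rewind i q' q'')"
    and "i < length ts" "ts ! i = tape_at u (map Bit bs)"
  shows "reaches M (length u + 2 + 2 * length bs) (q, ts)
    (q'', ts[i := tape_at [] (rev u @ map Bit (bits_succ bs))])"
  using assms(3,4)
proof (induction bs arbitrary: u ts rule: bits_succ.induct)
  case 1
  then have "step M (q, ts) = (q', ts[i := tape_before u [Bit True]])"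
    by (simp add: step_instr[OF assms(1)] increment_def map2_act_update map2_act_idle)
  moreover have "reaches M (length u + 1) (q', ts[i := tape_before u [Bit True]])
      (q'', ts[i := tape_at [] (rev u @ [Bit True])])"
    using reaches_rewind[OF assms(2), of "ts[i := tape_before u [Bit True]]" u] 1 by simp
  ultimately show ?case by (auto dest: reaches_Suc)
next
  case (2 bs)
  let ?v = "Bit True # map Bit bs"
  have "step M (q, ts) = (q', ts[i := tape_before u ?v])"
    using 2 by (simp add: step_instr[OF assms(1)] increment_def map2_act_update map2_act_idle)
  moreover have "reaches M (length u + 1) (q', ts[i := tape_before u ?v])
      (q'', ts[i := tape_at [] (rev u @ ?v)])"
    using reaches_rewind[OF assms(2), of "ts[i := tape_before u ?v]" u] 2 by simp
  ultimately have "reaches M (Suc (length u + 1)) (q, ts) (q'', ts[i := tape_at [] (rev u @ ?v)])"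
    by (rule reaches_Suc)
  then show ?case by (auto elim: reaches_mono)
next
  case (3 bs)
  let ?ts = "ts[i := tape_at (Bit False # u) (map Bit bs)]"
  have "step M (q, ts) = (q, ?ts)"
    using 3 by (simp add: step_instr[OF assms(1)] increment_def map2_act_update map2_act_idle)
  moreover have "reaches M (length (Bit False # u) + 2 + 2 * length bs) (q, ?ts)
      (q'', ?ts[i := tape_at [] (rev (Bit False # u) @ map Bit (bits_succ bs))])"
    using 3 by (intro "3.IH") simp_all
  ultimately have "reaches M (Suc (length (Bit False # u) + 2 + 2 * length bs)) (q, ts)
      (q'', ts[i := tape_at [] (rev (Bit False # u) @ map Bit (bits_succ bs))])"
    by (auto dest: reaches_Suc)
  then show ?case by simp
qed

lemma reaches_increment:
  assumes "has_instr M q (increment i q q')" "has_instr M q' (rewind i q' q'')"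
    and "i < length ts" "ts ! i = tape_at [] (bits n)"
  shows "reaches M (2 + 2 * n) (q, ts) (q'', ts[i := tape_at [] (bits (Suc n))])"
  using reaches_increment_bits[OF assms] length_binary[of n]
  by (auto simp: binary_Suc intro: reaches_mono)

text \<open>The bits of a number contain no separator, so the scan stops at the number's own
  terminator.\<close>

lemma reaches_next_sep:
  assumes "has_instr M q (next_sep q q' q'')" "0 < length ts" "ts ! 0 = tape_at u (map Bit bs @ Sep # v)"
  shows "reaches M (length bs + 1) (q, ts) (q', ts[0 := tape_at (Sep # rev (map Bit bs) @ u) v])"
  using assms(2,3)
proof (induction bs arbitrary: u ts)
  case Nil
  then have "step M (q, ts) = (q', ts[0 := tape_at (Sep # u) v])"
    by (simp add: step_instr[OF assms(1)] next_sep_def map2_act_update map2_act_idle)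
  then show ?case by (simp add: reaches_step)
next
  case (Cons b bs)
  let ?ts = "ts[0 := tape_at (Bit b # u) (map Bit bs @ Sep # v)]"
  have "step M (q, ts) = (q, ?ts)"
    using Cons.prems
    by (simp add: step_instr[OF assms(1)] next_sep_def map2_act_update map2_act_idle)
  moreover have "reaches M (length bs + 1) (q, ?ts)
      (q', ?ts[0 := tape_at (Sep # rev (map Bit bs) @ Bit b # u) v])"
    using Cons.prems by (intro Cons.IH) simp_all
  ultimately show ?case by (auto dest: reaches_Suc)
qed

lemma reaches_next_sep_end:
  assumes "has_instr M q (next_sep q q' q'')" "0 < length ts" "ts ! 0 = tape_at u []"
  shows "reaches M 1 (q, ts) (q'', ts[0 := tape_before u []])"
  using assms(2,3)
  by (auto intro!: reaches_step
      simp: step_instr[OF assms(1)] next_sep_def map2_act_update map2_act_idle)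

section \<open>A machine for the reduction\<close>

text \<open>Jump targets are absolute, so a block emitting a constant string depends on its start
  address.\<close>

fun puts :: "nat \<Rightarrow> symbol list \<Rightarrow> instr list" where
  "puts q [] = []"
| "puts q (x # xs) = put 1 x Move_Right (Suc q) # puts (Suc q) xs"

abbreviation "F \<equiv> Bit False"
abbreviation "T \<equiv> Bit True"

text \<open>
  The output tape first serves as a binary counter for the number of clients, starting from \<open>2\<close>;
  after the copy of the periods and the constant part, tape 2 counts through the labels
  \<open>3, \<dots>, n + 2\<close> while the input is read again.
\<close>

definition program :: "instr list" where
  "program =
    [put 1 F Move_Right 1, put 1 T Move_Left 2, rewind 1 2 3,
     put 2 F Move_Right 4, put 2 T Move_Left 5, rewind 2 5 6,
     next_sep 6 7 9, increment 1 7 8, rewind 1 8 6, forward 1 9 10] @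
    puts 10 [Sep, T, Sep, T, Sep] @
    [rewind 0 15 16, copy 0 16 17] @
    puts 17 [F, T, T, Sep, T, Sep,
      Sep, T, Sep, F, T, Sep, T, Sep, F, T, Sep, T, Sep, F, T, Sep, T, Sep] @
    [rewind 0 41 42, next_sep 42 43 63, increment 2 43 44, rewind 2 44 45] @
    puts 45 [Sep] @ [copy 2 46 47] @ puts 47 [Sep, T, Sep, T, Sep, F, T, Sep] @
    [rewind 2 55 56, copy 2 56 57] @ puts 57 [Sep, T, Sep, T, Sep] @ [rewind 2 62 42]"

text \<open>A state is the address of its instruction; the first address beyond the program is the
  halting state.\<close>

definition machine :: tm where
  "machine = \<lparr> ntapes = 3, nstates = 63, delta = \<lambda>q. program ! q \<rparr>"

lemmas program_list = program_def[simplified]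

lemma length_program: "length program = 63"
  by (simp add: program_list)

definition bounded_instr :: "nat \<Rightarrow> instr \<Rightarrow> bool" where
  "bounded_instr n ins \<longleftrightarrow> (\<forall>rs. fst (ins rs) \<le> n \<and> length (snd (ins rs)) = length rs)"

lemma bounded_instrs:
  "bounded_instr n (put i x m q') \<longleftrightarrow> q' \<le> n"
  "q \<le> n \<Longrightarrow> q' \<le> n \<Longrightarrow> bounded_instr n (rewind i q q')"
  "q \<le> n \<Longrightarrow> q' \<le> n \<Longrightarrow> bounded_instr n (forward i q q')"
  "q \<le> n \<Longrightarrow> q' \<le> n \<Longrightarrow> bounded_instr n (increment i q q')"
  "q \<le> n \<Longrightarrow> q' \<le> n \<Longrightarrow> bounded_instr n (copy i q q')"
  "q \<le> n \<Longrightarrow> q' \<le> n \<Longrightarrow> q'' \<le> n \<Longrightarrow> bounded_instr n (next_sep q q' q'')"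
  by (simp_all add: bounded_instr_def put_def rewind_def forward_def increment_def copy_def
      next_sep_def split: option.split)

lemma wf_machine: "wf_tm machine"
proof -
  have "list_all (bounded_instr 63) program"
    by (simp add: program_list bounded_instrs)
  then have "bounded_instr 63 (program ! q)" if "q < 63" for q
    using that by (simp add: list_all_length length_program)
  then show ?thesis
    by (simp add: wf_tm_def machine_def bounded_instr_def)
qed

lemma has_instr_machine: "has_instr machine q ins \<longleftrightarrow> q \<noteq> 63 \<and> program ! q = ins"
  by (simp add: has_instr_def machine_def)

text \<open>The addresses left out belong to constant blocks and are handled by
  \<open>reaches_machine_puts\<close>. Unfolding \<open>1\<close> matches the simplifier's normal
  form.\<close>

lemma machine_instrs [unfolded One_nat_def, simp]:
  "has_instr machine 0 (put 1 F Move_Right 1)"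
  "has_instr machine 1 (put 1 T Move_Left 2)"
  "has_instr machine 2 (rewind 1 2 3)"
  "has_instr machine 3 (put 2 F Move_Right 4)"
  "has_instr machine 4 (put 2 T Move_Left 5)"
  "has_instr machine 5 (rewind 2 5 6)"
  "has_instr machine 6 (next_sep 6 7 9)"
  "has_instr machine 7 (increment 1 7 8)"
  "has_instr machine 8 (rewind 1 8 6)"
  "has_instr machine 9 (forward 1 9 10)"
  "has_instr machine 15 (rewind 0 15 16)"
  "has_instr machine 16 (copy 0 16 17)"
  "has_instr machine 41 (rewind 0 41 42)"
  "has_instr machine 42 (next_sep 42 43 63)"
  "has_instr machine 43 (increment 2 43 44)"
  "has_instr machine 44 (rewind 2 44 45)"
  "has_instr machine 45 (put 1 Sep Move_Right 46)"
  "has_instr machine 46 (copy 2 46 47)"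
  "has_instr machine 55 (rewind 2 55 56)"
  "has_instr machine 56 (copy 2 56 57)"
  "has_instr machine 62 (rewind 2 62 42)"
  by (simp_all add: has_instr_machine program_list)

lemma puts_nth: "j < length xs \<Longrightarrow> puts q xs ! j = put 1 (xs ! j) Move_Right (Suc (q + j))"
  by (induction xs arbitrary: q j) (auto simp: nth_Cons split: nat.split)

lemma length_puts [simp]: "length (puts q xs) = length xs"
  by (induction xs arbitrary: q) auto

lemma reaches_machine_puts:
  assumes "take n (drop q program) = puts q xs" "n = length xs" "q' = q + n" "q' < 63"
  shows "reaches machine n (q, [A, tape_at w [], C]) (q', [A, tape_at (rev xs @ w) [], C])"
proof -
  have "has_instr machine (q + j) (put 1 (xs ! j) Move_Right (Suc (q + j)))"
    if "j < length xs" for j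
  proof -
    have "program ! (q + j) = take n (drop q program) ! j"
      using that assms(2-) by (simp add: length_program)
    also have "\<dots> = put 1 (xs ! j) Move_Right (Suc (q + j))"
      using that by (simp only: assms(1) puts_nth)
    finally show ?thesis
      using that assms(2-) by (simp add: has_instr_machine)
  qed
  from reaches_puts[OF this, of "[A, tape_at w [], C]" w] show ?thesis
    by (simp add: assms(2,3))
qed

text \<open>
  The constant pieces of the output. Those before which a number has been copied start with its
  separator: \<open>header_code\<close> continues with \<open>1, 1\<close>; \<open>bound_code\<close> is \<open>6, 1\<close> followed by the edges
  \<open>0, 1, 2, 1\<close> and \<open>2, 1, 2, 1\<close>; \<open>depot_edge_code\<close> completes \<open>0, v, 1, 1\<close> and opens the next edge
  with \<open>2\<close>; \<open>far_edge_code\<close> completes \<open>2, v, 1, 1\<close>.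
\<close>

definition header_code :: "symbol list" where
  "header_code = [Sep, T, Sep, T, Sep]"

definition bound_code :: "symbol list" where
  "bound_code = [F, T, T, Sep, T, Sep,
    Sep, T, Sep, F, T, Sep, T, Sep, F, T, Sep, T, Sep, F, T, Sep, T, Sep]"

definition depot_edge_code :: "symbol list" where
  "depot_edge_code = [Sep, T, Sep, T, Sep, F, T, Sep]"

definition far_edge_code :: "symbol list" where
  "far_edge_code = [Sep, T, Sep, T, Sep]"

lemma code_lengths [simp]:
  "length header_code = 5" "length bound_code = 24"
  "length depot_edge_code = 8" "length far_edge_code = 5"
  by (simp_all add: header_code_def bound_code_def depot_edge_code_def far_edge_code_def)

lemma program_puts:
  "take 5 (drop 10 program) = puts 10 header_code"
  "take 24 (drop 17 program) = puts 17 bound_code"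
  "take 8 (drop 47 program) = puts 47 depot_edge_code"
  "take 5 (drop 57 program) = puts 57 far_edge_code"
  by (simp_all add: program_list header_code_def bound_code_def depot_edge_code_def far_edge_code_def)

lemmas machine_puts = program_puts[THEN reaches_machine_puts]

lemma encode_nats_Nil [simp]: "encode_nats [] = []"
  by (simp add: encode_nats_def)

lemma encode_nats_Cons: "encode_nats (n # ns) = bits n @ Sep # encode_nats ns"
  by (simp add: encode_nats_def)

lemma encode_nats_append: "encode_nats (ms @ ns) = encode_nats ms @ encode_nats ns"
  by (simp add: encode_nats_def)

text \<open>Every number contributes at least its separator; this bounds the number of periods by
  the input length.\<close>

lemma length_encode_nats: "length ns \<le> length (encode_nats ns)"
  by (induction ns) (simp_all add: encode_nats_Cons)

section \<open>The two passes over the input\<close>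

lemma count_loop:
  assumes "x + length ns \<le> m"
  shows "reaches machine ((2 * m + 3) * length (encode_nats ns) + 1)
    (6, [tape_at u (encode_nats ns), tape_at [] (bits x), C])
    (9, [tape_before (rev (encode_nats ns) @ u) [], tape_at [] (bits (x + length ns)), C])"
  using assms
proof (induction ns arbitrary: u x)
  case Nil
  have "has_instr machine 6 (next_sep 6 7 9)"
    by simp
  from reaches_next_sep_end[OF this, of "[tape_at u [], tape_at [] (bits x), C]" u]
  show ?case by simp
next
  case (Cons n ns)
  let ?u = "Sep # rev (bits n) @ u" and ?v = "encode_nats ns"
  have "reaches machine (length (binary n) + 1)
      (6, [tape_at u (encode_nats (n # ns)), tape_at [] (bits x), C])
      (7, [tape_at ?u ?v, tape_at [] (bits x), C])"
    using reaches_next_sep[of machine 6 7 9 "[tape_at u (encode_nats (n # ns)), tape_at [] (bits x), C]"]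
    by (simp add: encode_nats_Cons)
  also have "reaches machine (2 + 2 * x) \<dots>
      (6, [tape_at ?u ?v, tape_at [] (bits (Suc x)), C])"
    using reaches_increment[of machine 7 1 8 6 "[tape_at ?u ?v, tape_at [] (bits x), C]" x]
    by simp
  also have "reaches machine ((2 * m + 3) * length ?v + 1) \<dots>
      (9, [tape_before (rev ?v @ ?u) [], tape_at [] (bits (Suc x + length ns)), C])"
    using Cons.prems by (intro Cons.IH) simp
  finally have "reaches machine
      (length (binary n) + 1 + (2 + 2 * x) + ((2 * m + 3) * length ?v + 1))
      (6, [tape_at u (encode_nats (n # ns)), tape_at [] (bits x), C])
      (9, [tape_before (rev (encode_nats (n # ns)) @ u) [],
        tape_at [] (bits (x + length (n # ns))), C])"
    by (simp add: encode_nats_Cons)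
  then show ?case
  proof (rule reaches_mono)
    \<comment> \<open>The uniform bound \<open>m\<close> on the counter charges each input symbol
      \<open>2 * m + 3\<close> steps; the separator alone pays for the increment.\<close>
    have "length (binary n) + 2 * x \<le> (2 * m + 3) * length (binary n) + 2 * m"
      using Cons.prems by (intro add_mono) simp_all
    then show "length (binary n) + 1 + (2 + 2 * x) + ((2 * m + 3) * length ?v + 1)
        \<le> (2 * m + 3) * length (encode_nats (n # ns)) + 1"
      by (simp add: encode_nats_Cons algebra_simps)
  qed
qed

text \<open>The leading separator is the whole code of the endpoint \<open>0\<close>, whose binary
  expansion is empty.\<close>

definition spoke_code :: "nat \<Rightarrow> symbol list" where
  "spoke_code v = [Sep] @ bits v @ depot_edge_code @ bits v @ far_edge_code"

text \<open>Incrementing first makes the initial value 2 yield the label 3. Two copies and two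
  rewinds traverse the counter four times, which together with the increment gives the linear
  bound.\<close>

lemma emit_spoke:
  "reaches machine (6 * x + 30)
    (43, [A, tape_at w [], tape_at [] (bits x)])
    (42, [A, tape_at (rev (spoke_code (Suc x)) @ w) [], tape_at [] (bits (Suc x))])"
proof -
  let ?b = "bits (Suc x)" and ?C = "tape_at [] (bits (Suc x))"
    and ?C' = "tape_before (rev (bits (Suc x))) []"
  let ?w1 = "Sep # w" and ?s = depot_edge_code and ?t = far_edge_code
  let ?w2 = "rev ?b @ ?w1"
  let ?w3 = "rev ?s @ ?w2"
  let ?w4 = "rev ?b @ ?w3"
  have "reaches machine (2 + 2 * x) (43, [A, tape_at w [], tape_at [] (bits x)])
      (45, [A, tape_at w [], ?C])"
    using reaches_increment[of machine 43 2 44 45 "[A, tape_at w [], tape_at [] (bits x)]" x]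
    by simp
  also have "reaches machine 1 \<dots> (46, [A, tape_at ?w1 [], ?C])"
    using reaches_put_right[of machine 45 1 Sep 46 "[A, tape_at w [], ?C]" w]
    by simp
  also have "reaches machine (length ?b + 1) \<dots> (47, [A, tape_at ?w2 [], ?C'])"
    using reaches_copy[of machine 46 2 47 "[A, tape_at ?w1 [], ?C]" "[]" ?b ?w1]
    by simp
  also have "reaches machine 8 \<dots> (55, [A, tape_at ?w3 [], ?C'])"
    by (rule machine_puts) simp_all
  also have "reaches machine (length ?b + 1) \<dots> (56, [A, tape_at ?w3 [], ?C])"
    using reaches_rewind[of machine 55 2 56 "[A, tape_at ?w3 [], ?C']" "rev ?b" "[]"]
    by simp
  also have "reaches machine (length ?b + 1) \<dots> (57, [A, tape_at ?w4 [], ?C'])"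
    using reaches_copy[of machine 56 2 57 "[A, tape_at ?w3 [], ?C]" "[]" ?b ?w3]
    by simp
  also have "reaches machine 5 \<dots> (62, [A, tape_at (rev ?t @ ?w4) [], ?C'])"
    by (rule machine_puts) simp_all
  also have "reaches machine (length ?b + 1) \<dots> (42, [A, tape_at (rev ?t @ ?w4) [], ?C])"
    using reaches_rewind[of machine 62 2 42 "[A, tape_at (rev ?t @ ?w4) [], ?C']" "rev ?b" "[]"]
    by simp
  also have "rev ?t @ ?w4 = rev (spoke_code (Suc x)) @ w"
    by (simp add: spoke_code_def)
  finally show ?thesis
    using length_binary[of "Suc x"] by (auto elim: reaches_mono)
qed

text \<open>The input numbers serve only to count iterations: each one passed triggers the two edges
  of the next label.\<close>

lemma emit_loop:
  assumes "x + length ns \<le> m"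
  shows "reaches machine ((6 * m + 31) * length (encode_nats ns) + 1)
    (42, [tape_at u (encode_nats ns), tape_at w [], tape_at [] (bits x)])
    (63, [tape_before (rev (encode_nats ns) @ u) [],
      tape_at (rev (concat (map spoke_code [Suc x..<Suc x + length ns])) @ w) [],
      tape_at [] (bits (x + length ns))])"
  using assms
proof (induction ns arbitrary: u w x)
  case Nil
  have "has_instr machine 42 (next_sep 42 43 63)"
    by simp
  from reaches_next_sep_end[OF this, of "[tape_at u [], tape_at w [], tape_at [] (bits x)]" u]
  show ?case by simp
next
  case (Cons n ns)
  let ?u = "Sep # rev (bits n) @ u" and ?v = "encode_nats ns"
  have "reaches machine (length (binary n) + 1)
      (42, [tape_at u (encode_nats (n # ns)), tape_at w [], tape_at [] (bits x)])
      (43, [tape_at ?u ?v, tape_at w [], tape_at [] (bits x)])"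
    using reaches_next_sep[of machine 42 43 63
        "[tape_at u (encode_nats (n # ns)), tape_at w [], tape_at [] (bits x)]"]
    by (simp add: encode_nats_Cons)
  also have "reaches machine (6 * x + 30) \<dots>
      (42, [tape_at ?u ?v, tape_at (rev (spoke_code (Suc x)) @ w) [], tape_at [] (bits (Suc x))])"
    by (rule emit_spoke)
  also have "reaches machine ((6 * m + 31) * length ?v + 1) \<dots>
      (63, [tape_before (rev ?v @ ?u) [],
        tape_at (rev (concat (map spoke_code [Suc (Suc x)..<Suc (Suc x) + length ns])) @
          rev (spoke_code (Suc x)) @ w) [],
        tape_at [] (bits (Suc x + length ns))])"
    using Cons.prems by (intro Cons.IH) simp
  also have "rev (concat (map spoke_code [Suc (Suc x)..<Suc (Suc x) + length ns])) @
      rev (spoke_code (Suc x)) @ w =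
      rev (concat (map spoke_code [Suc x..<Suc x + length (n # ns)])) @ w"
    by (subst (2) upt_conv_Cons) simp_all
  finally have "reaches machine
      (length (binary n) + 1 + (6 * x + 30) + ((6 * m + 31) * length ?v + 1))
      (42, [tape_at u (encode_nats (n # ns)), tape_at w [], tape_at [] (bits x)])
      (63, [tape_before (rev (encode_nats (n # ns)) @ u) [],
        tape_at (rev (concat (map spoke_code [Suc x..<Suc x + length (n # ns)])) @ w) [],
        tape_at [] (bits (x + length (n # ns)))])"
    by (simp add: encode_nats_Cons del: upt_Suc)
  then show ?case
  proof (rule reaches_mono)
    have "length (binary n) + 6 * x \<le> (6 * m + 31) * length (binary n) + 6 * m"
      using Cons.prems by (intro add_mono) simp_all
    then show "length (binary n) + 1 + (6 * x + 30) + ((6 * m + 31) * length ?v + 1)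
        \<le> (6 * m + 31) * length (encode_nats (n # ns)) + 1"
      by (simp add: encode_nats_Cons algebra_simps)
  qed
qed

section \<open>The output and the total running time\<close>

text \<open>The output in the order of writing. The first number lacks its separator, which
  \<open>header_code\<close> supplies.\<close>

definition reduction_code :: "nat list \<Rightarrow> symbol list" where
  "reduction_code ps = bits (length ps + 2) @ header_code @ encode_nats ps @ bound_code @
    concat (map spoke_code [3..<length ps + 3])"

lemma nats_of_rat_of_nat: "nats_of_rat (of_nat n) = [n, 1]"
  by (simp add: nats_of_rat_def of_nat_rat quotient_of_Fract normalize_def)

text \<open>All weights and the bound are integers and get denominator 1, and the encoded periods
  reappear verbatim, so that the machine can copy them.\<close>

lemma encode_reduction: "encode_rftt (reduction ps) = reduction_code ps"
proof -
  have rats: "nats_of_rat 1 = [1, 1]" "nats_of_rat 2 = [2, 1]" "nats_of_rat 6 = [6, 1]"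
    using nats_of_rat_of_nat[of 1] nats_of_rat_of_nat[of 2] nats_of_rat_of_nat[of 6] by simp_all
  have small: "binary 0 = []" "binary 1 = [True]" "binary 2 = [False, True]"
      "binary 6 = [False, True, True]"
    by (simp_all add: binary.simps)
  have code: "encode_nats (concat (map (\<lambda>(u, v, q). [u, v] @ nats_of_rat q) (spoke_edges v)))
      = spoke_code v" if "3 \<le> v" for v
    using that
    by (simp add: spoke_edges_def rats spoke_cost_def encode_nats_Cons spoke_code_def
        depot_edge_code_def far_edge_code_def small small[unfolded One_nat_def])
  have "encode_nats (concat (map (\<lambda>(u, v, q). [u, v] @ nats_of_rat q)
      (concat (map spoke_edges vs)))) = concat (map spoke_code vs)" if "\<forall>v\<in>set vs. 3 \<le> v" for vs
    using that by (induction vs) (simp_all add: encode_nats_append code[simplified])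
  from this[of "[3..<length ps + 3]"] show ?thesis
    by (simp add: encode_rftt_def reduction_def reduction_code_def encode_nats_Cons
        encode_nats_append rats small small[unfolded One_nat_def] spoke_edges_def[of "Suc 0"]
        spoke_cost_def header_code_def bound_code_def)
qed

lemma machine_run:
  fixes ps
  defines "N \<equiv> length (encode_nats ps)"
  shows "\<exists>A C. reaches machine (8 * (N * N) + 100 * N + 100)
    (initial_config machine (encode_nats ps))
    (63, [A, tape_at (rev (reduction_code ps)) [], C])"
proof -
  let ?p = "encode_nats ps" and ?n = "length ps" and ?b = "bits (2 + length ps)"
  let ?A = "tape_at [] ?p" and ?A' = "tape_before (rev ?p) []"
  let ?C = "tape_at [] [F, T]"
  let ?s = header_code and ?t = bound_code
  \<comment> \<open>The output after successive phases, reversed as in \<open>tape_at\<close>: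
    client count, header, periods, bound with the edges at \<open>1\<close>, and the edges at the
    jobs.\<close>
  let ?w1 = "rev ?b"
  let ?w2 = "rev ?s @ ?w1"
  let ?w3 = "rev ?p @ ?w2"
  let ?w4 = "rev ?t @ ?w3"
  let ?w5 = "rev (concat (map spoke_code [Suc 2..<Suc 2 + ?n])) @ ?w4"
  have two: "bits 2 = [F, T]" by (simp add: binary.simps)
  have "initial_config machine ?p = (0, [?A, tape_at [] [], tape_at [] []])"
    by (simp add: initial_config_def machine_def tape_at_def numeral_2_eq_2)
  also have "reaches machine 1 \<dots> (1, [?A, tape_at [F] [], tape_at [] []])"
    using reaches_put_right[of machine 0 1 F 1 "[?A, tape_at [] [], tape_at [] []]" "[]"]
    by simp
  also have "reaches machine 1 \<dots> (2, [?A, tape_before [F] [T], tape_at [] []])"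
    using reaches_put_left[of machine 1 1 T 2 "[?A, tape_at [F] [], tape_at [] []]" "[F]"]
    by simp
  also have "reaches machine (Suc (Suc 0)) \<dots> (3, [?A, ?C, tape_at [] []])"
    using reaches_rewind[of machine 2 1 3 "[?A, tape_before [F] [T], tape_at [] []]" "[F]" "[T]"]
    by simp
  also have "reaches machine 1 \<dots> (4, [?A, ?C, tape_at [F] []])"
    using reaches_put_right[of machine 3 2 F 4 "[?A, ?C, tape_at [] []]" "[]"]
    by simp
  also have "reaches machine 1 \<dots> (5, [?A, ?C, tape_before [F] [T]])"
    using reaches_put_left[of machine 4 2 T 5 "[?A, ?C, tape_at [F] []]" "[F]"]
    by simp
  also have "reaches machine (Suc (Suc 0)) \<dots> (6, [?A, ?C, ?C])"
    using reaches_rewind[of machine 5 2 6 "[?A, ?C, tape_before [F] [T]]" "[F]" "[T]"]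
    by simp
  also have "reaches machine ((2 * (2 + ?n) + 3) * N + 1) \<dots>
      (9, [?A', tape_at [] ?b, ?C])"
    using count_loop[of 2 ps "2 + ?n" "[]" ?C, unfolded two] by (simp add: N_def)
  also have "reaches machine (length ?b + 1) \<dots> (10, [?A', tape_at ?w1 [], ?C])"
    using reaches_forward[of machine 9 1 10 "[?A', tape_at [] ?b, ?C]" "[]" ?b]
    by simp
  also have "reaches machine 5 \<dots> (15, [?A', tape_at ?w2 [], ?C])"
    by (rule machine_puts) simp_all
  also have "reaches machine (N + 1) \<dots> (16, [?A, tape_at ?w2 [], ?C])"
    using reaches_rewind[of machine 15 0 16 "[?A', tape_at ?w2 [], ?C]" "rev ?p" "[]"]
    by (simp add: N_def)
  also have "reaches machine (N + 1) \<dots> (17, [?A', tape_at ?w3 [], ?C])"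
    using reaches_copy[of machine 16 0 17 "[?A, tape_at ?w2 [], ?C]" "[]" ?p ?w2]
    by (simp add: N_def)
  also have "reaches machine 24 \<dots> (41, [?A', tape_at ?w4 [], ?C])"
    by (rule machine_puts) simp_all
  also have "reaches machine (N + 1) \<dots> (42, [?A, tape_at ?w4 [], ?C])"
    using reaches_rewind[of machine 41 0 42 "[?A', tape_at ?w4 [], ?C]" "rev ?p" "[]"]
    by (simp add: N_def)
  also have "reaches machine ((6 * (2 + ?n) + 31) * N + 1) \<dots>
      (63, [?A', tape_at ?w5 [], tape_at [] ?b])"
    using emit_loop[of 2 ps "2 + ?n" "[]" ?w4, unfolded two] by (simp add: N_def del: upt_Suc)
  also have "?w5 = rev (reduction_code ps)"
    by (simp add: reduction_code_def add.commute numeral_3_eq_3 numeral_2_eq_2 del: upt_Suc)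
  finally have "reaches machine
      (1 + 1 + Suc (Suc 0) + 1 + 1 + Suc (Suc 0) + ((2 * (2 + ?n) + 3) * N + 1) + (length ?b + 1) + 5
        + (N + 1) + (N + 1) + 24 + (N + 1) + ((6 * (2 + ?n) + 31) * N + 1))
      (initial_config machine ?p)
      (63, [?A', tape_at (rev (reduction_code ps)) [], tape_at [] ?b])" .
  moreover have "1 + 1 + Suc (Suc 0) + 1 + 1 + Suc (Suc 0) + ((2 * (2 + ?n) + 3) * N + 1) + (length ?b + 1) + 5
        + (N + 1) + (N + 1) + 24 + (N + 1) + ((6 * (2 + ?n) + 31) * N + 1)
      \<le> 8 * (N * N) + 100 * N + 100"
  proof -
    have "?n \<le> N" "length ?b \<le> 2 + ?n"
      using length_encode_nats[of ps] length_binary[of "2 + ?n"] by (simp_all add: N_def)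
    \<comment> \<open>The two loops contribute \<open>2 * n * N\<close> and \<open>6 * n * N\<close>
      to the time, with \<open>n\<close> periods; the other terms are linear in \<open>N\<close> and
      \<open>n\<close>.\<close>
    moreover from this have "?n * N \<le> N * N" by simp
    moreover have "1 + 1 + Suc (Suc 0) + 1 + 1 + Suc (Suc 0) + ((2 * (2 + ?n) + 3) * N + 1)
        + (length ?b + 1) + 5 + (N + 1) + (N + 1) + 24 + (N + 1) + ((6 * (2 + ?n) + 31) * N + 1)
      = 8 * (?n * N) + 53 * N + length ?b + 43"
      by (simp add: algebra_simps)
    ultimately show ?thesis by linarith
  qed
  ultimately show ?thesis by (blast intro: reaches_mono)
qed

lemma poly_time_reduction: "poly_time_map pinwheel min_avg_rftt_series_parallel reduction"
proof -
  let ?p = "[:100, 100, 8:] :: nat poly"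
  have "outputs_within machine (encode_nats ps) (encode_rftt (reduction ps))
      (poly ?p (length (encode_nats ps)))" for ps
  proof -
    let ?N = "length (encode_nats ps)"
    obtain A C where run: "reaches machine (8 * (?N * ?N) + 100 * ?N + 100)
        (initial_config machine (encode_nats ps))
        (63, [A, tape_at (rev (reduction_code ps)) [], C])"
      using machine_run by blast
    have eq: "poly ?p ?N = 8 * (?N * ?N) + 100 * ?N + 100"
      by (simp add: algebra_simps)
    have halt: "nstates machine = 63" by (simp add: machine_def)
    show ?thesis
      unfolding eq encode_reduction
    proof (rule outputs_within_reaches)
      show "reaches machine (8 * (?N * ?N) + 100 * ?N + 100)
          (initial_config machine (encode_nats ps))
          (nstates machine, [A, tape_at (rev (reduction_code ps)) [], C])"
        unfolding halt by (rule run)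
    qed (simp add: tape_at_def)
  qed
  then show ?thesis
    unfolding poly_time_map_def
    by (intro exI[of _ machine] exI[of _ ?p])
      (simp add: wf_machine pinwheel_def min_avg_rftt_series_parallel_def min_avg_rftt_def)
qed

theorem theorem1:
  "poly_time_many_one_reducible pinwheel min_avg_rftt_series_parallel"
proof -
  have "yes pinwheel ps \<longleftrightarrow> yes min_avg_rftt_series_parallel (reduction ps)" for ps
    using reduction_complete reduction_sound[of ps]
    by (auto simp: pinwheel_def min_avg_rftt_series_parallel_def min_avg_rftt_def reduction_def)
  moreover have "reduction ps \<in> instances min_avg_rftt_series_parallel"
    if "ps \<in> instances pinwheel" for ps
    using that by (intro reduction_instance) (simp add: pinwheel_def)
  ultimately show ?thesis
    unfolding poly_time_many_one_reducible_def using poly_time_reduction by blast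
qed

end
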